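(* Let $X$ and $Y$ be Hausdorff spaces without isolated points such that each of $X$ and $Y$ has a $\pi$-pseudobase consisting of connected compact $C_1$-sets, and let $f:X\times Y\to X\times Y$ be the identity mapping, $f(x,y)=(x,y)$. Then $f\notin B_1(X\times Y,(X\times Y,\gamma))$; that is, $f$, regarded as a mapping from $X\times Y$ with the product topology to $X\times Y$ with the cross-topology $\gamma$, is not a pointwise limit of a sequence of continuous mappings from $X\times Y$ to $(X\times Y,\gamma)$.
   Context: Topological spaces are assumed nonempty. Cross-topology: for topological spaces $X$ and $Y$, $\gamma$ is the collection of all subsets $A$ of $X\times Y$ such that for every point $(x,y)\in A$ there exist neighborhoods $U$ of $x$ in $X$ and $V$ of $y$ in $Y$ with $(\{x\}\times V)\cup(U\times\{y\})\subseteq A$. This is a topology on $X\times Y$, called the cross-topology; $(X\times Y,\gamma)$ denotes $X\times Y$ with this topology, while $X\times Y$ alone carries the product topology. A $\pi$-pseudobase of a topological space $X$ is a system $\mathcal A$ of subsets of $X$ such that for every nonempty open set $U\subseteq X$ there exists $A\in\mathcal A$ with $\mathrm{int}(A)\neq\emptyset$ and $A\subseteq U$. A topological space is a $C_1$-space if the complement of any finite subset has only finitely many connected components. A $C_1$-set is a subset which is a $C_1$-space in the subspace topology. For topological spaces $S$ and $T$, $B_1(S,T)$ is the set of mappings $f:S\to T$ of the first Baire class, i.e. those for which there is a sequence of continuous mappings $f_n:S\to T$ with $f_n(s)\to f(s)$ in $T$ for every $s\in S$. *)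

theory Defs
  imports "HOL-Analysis.Analysis"
begin

definition cross_open :: "'a topology \<Rightarrow> 'b topology \<Rightarrow> ('a \<times> 'b) set \<Rightarrow> bool" where
  "cross_open X Y A \<longleftrightarrow>
     A \<subseteq> topspace X \<times> topspace Y \<and>
     (\<forall>x y. (x, y) \<in> A \<longrightarrow>
        (\<exists>U V. openin X U \<and> x \<in> U \<and> openin Y V \<and> y \<in> V \<and>
               ({x} \<times> V) \<union> (U \<times> {y}) \<subseteq> A))"

definition cross_topology :: "'a topology \<Rightarrow> 'b topology \<Rightarrow> ('a \<times> 'b) topology" where
  "cross_topology X Y = topology (cross_open X Y)"

lemma cross_open_nbhds:
  assumes "cross_open X Y A" and "(x, y) \<in> A"
  obtains U V where "openin X U" "x \<in> U" "openin Y V" "y \<in> V"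
    "({x} \<times> V) \<union> (U \<times> {y}) \<subseteq> A"
proof -
  have "\<forall>x y. (x, y) \<in> A \<longrightarrow>
        (\<exists>U V. openin X U \<and> x \<in> U \<and> openin Y V \<and> y \<in> V \<and>
               ({x} \<times> V) \<union> (U \<times> {y}) \<subseteq> A)"
    using assms(1) unfolding cross_open_def by (rule conjunct2)
  from this[rule_format, OF assms(2)] show thesis
    by (elim exE conjE) (rule that)
qed

lemma istopology_cross_open: "istopology (cross_open X Y)"
  unfolding istopology_def
proof (intro conjI allI impI)
  fix S T assume S: "cross_open X Y S" and T: "cross_open X Y T"
  show "cross_open X Y (S \<inter> T)"
    unfolding cross_open_def
  proof (intro conjI allI impI)
    show "S \<inter> T \<subseteq> topspace X \<times> topspace Y"
      using S unfolding cross_open_def by blast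
    fix x y assume xy: "(x, y) \<in> S \<inter> T"
    obtain U V where UV: "openin X U" "x \<in> U" "openin Y V" "y \<in> V"
        "({x} \<times> V) \<union> (U \<times> {y}) \<subseteq> S"
      by (rule cross_open_nbhds[OF S IntD1[OF xy]])
    obtain U' V' where UV': "openin X U'" "x \<in> U'" "openin Y V'" "y \<in> V'"
        "({x} \<times> V') \<union> (U' \<times> {y}) \<subseteq> T"
      by (rule cross_open_nbhds[OF T IntD2[OF xy]])
    show "\<exists>U V. openin X U \<and> x \<in> U \<and> openin Y V \<and> y \<in> V \<and>
               ({x} \<times> V) \<union> (U \<times> {y}) \<subseteq> S \<inter> T"
    proof (intro exI conjI)
      show "openin X (U \<inter> U')" using UV(1) UV'(1) by (rule openin_Int)
      show "openin Y (V \<inter> V')" using UV(3) UV'(3) by (rule openin_Int)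
      show "x \<in> U \<inter> U'" using UV(2) UV'(2) by (rule IntI)
      show "y \<in> V \<inter> V'" using UV(4) UV'(4) by (rule IntI)
      show "({x} \<times> (V \<inter> V')) \<union> ((U \<inter> U') \<times> {y}) \<subseteq> S \<inter> T"
        using UV(5) UV'(5) by blast
    qed
  qed
next
  fix K assume K: "\<forall>S\<in>K. cross_open X Y S"
  show "cross_open X Y (\<Union>K)"
    unfolding cross_open_def
  proof (intro conjI allI impI)
    show "\<Union>K \<subseteq> topspace X \<times> topspace Y"
      using K unfolding cross_open_def by blast
    fix x y assume "(x, y) \<in> \<Union>K"
    then obtain S where S: "S \<in> K" "(x, y) \<in> S" by blast
    obtain U V where UV: "openin X U" "x \<in> U" "openin Y V" "y \<in> V"
        "({x} \<times> V) \<union> (U \<times> {y}) \<subseteq> S"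
      by (rule cross_open_nbhds[OF K[rule_format, OF S(1)] S(2)])
    have "S \<subseteq> \<Union>K" using S(1) by (rule Union_upper)
    with UV show "\<exists>U V. openin X U \<and> x \<in> U \<and> openin Y V \<and> y \<in> V \<and>
               ({x} \<times> V) \<union> (U \<times> {y}) \<subseteq> \<Union>K"
      by (meson order_trans)
  qed
qed

lemma openin_cross_topology: "openin (cross_topology X Y) = cross_open X Y"
  unfolding cross_topology_def using istopology_cross_open by (rule topology_inverse')

lemma topspace_cross_topology: "topspace (cross_topology X Y) = topspace X \<times> topspace Y"
proof (rule subset_antisym)
  have "cross_open X Y (topspace (cross_topology X Y))"
    using openin_topspace[of "cross_topology X Y"] by (simp only: openin_cross_topology)
  then show "topspace (cross_topology X Y) \<subseteq> topspace X \<times> topspace Y"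
    unfolding cross_open_def by (rule conjunct1)
  have "cross_open X Y (topspace X \<times> topspace Y)"
    unfolding cross_open_def
  proof (intro conjI allI impI)
    fix x y assume "(x, y) \<in> topspace X \<times> topspace Y"
    then show "\<exists>U V. openin X U \<and> x \<in> U \<and> openin Y V \<and> y \<in> V \<and>
               ({x} \<times> V) \<union> (U \<times> {y}) \<subseteq> topspace X \<times> topspace Y"
      by (intro exI[of _ "topspace X"] exI[of _ "topspace Y"]) auto
  qed simp
  then show "topspace X \<times> topspace Y \<subseteq> topspace (cross_topology X Y)"
    by (intro openin_subset) (simp only: openin_cross_topology)
qed

definition pi_pseudobase :: "'a topology \<Rightarrow> 'a set set \<Rightarrow> bool" where
  "pi_pseudobase X \<A> \<longleftrightarrow>
     (\<forall>A\<in>\<A>. A \<subseteq> topspace X) \<and>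
     (\<forall>U. openin X U \<and> U \<noteq> {} \<longrightarrow> (\<exists>A\<in>\<A>. X interior_of A \<noteq> {} \<and> A \<subseteq> U))"

definition C1_space :: "'a topology \<Rightarrow> bool" where
  "C1_space X \<longleftrightarrow>
     (\<forall>F. finite F \<and> F \<subseteq> topspace X \<longrightarrow>
        finite (connected_components_of (subtopology X (topspace X - F))))"

definition C1_set :: "'a topology \<Rightarrow> 'a set \<Rightarrow> bool" where
  "C1_set X A \<longleftrightarrow> A \<subseteq> topspace X \<and> C1_space (subtopology X A)"

definition isolated_point_of :: "'a topology \<Rightarrow> 'a \<Rightarrow> bool" where
  "isolated_point_of X x \<longleftrightarrow> x \<in> topspace X \<and> openin X {x}"

(* Values of f outside topspace S are irrelevant; limitin already forces f to map
   topspace S into topspace T. *)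
definition baire_class_1 :: "'a topology \<Rightarrow> 'b topology \<Rightarrow> ('a \<Rightarrow> 'b) set" where
  "baire_class_1 S T =
     {f. \<exists>g :: nat \<Rightarrow> 'a \<Rightarrow> 'b.
           (\<forall>n. continuous_map S T (g n)) \<and>
           (\<forall>s\<in>topspace S. limitin T (\<lambda>n. g n s) (f s) sequentially)}"

end

theory Submission
  imports Defs
begin

text \<open>A compact set in the cross-topology lies in finitely many horizontal and vertical lines, and a
  sequence converging in the cross-topology eventually stays in the cross through its limit.
  If continuous maps \<open>g n\<close> converge pointwise to the identity, then by Baire's theorem there are \<open>m\<close>
  and a box \<open>A \<times> B\<close> with \<open>A\<close>, \<open>B\<close> connected, compact and infinite, such that every \<open>g n\<close> with
  \<open>n \<ge> m\<close> preserves at least one coordinate of each point of the box. The image of the box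
  lies in finitely many lines, so by connectedness one coordinate of \<open>g n\<close> is constant on the box;
  this cannot hold for all large \<open>n\<close>.\<close>

section \<open>Closed sets, compact sets and convergent sequences in the cross-topology\<close>

lemma cross_open_iff:
  "openin (cross_topology X Y) A \<longleftrightarrow>
     A \<subseteq> topspace X \<times> topspace Y \<and>
     (\<forall>x y. (x, y) \<in> A \<longrightarrow>
        (\<exists>U V. openin X U \<and> x \<in> U \<and> openin Y V \<and> y \<in> V \<and> {x} \<times> V \<union> U \<times> {y} \<subseteq> A))"
  by (simp only: openin_cross_topology cross_open_def)

lemma openin_cross_topology_if_openin_prod:
  assumes "openin (prod_topology X Y) W"
  shows "openin (cross_topology X Y) W"
  unfolding cross_open_iff
proof (intro conjI allI impI)
  show "W \<subseteq> topspace X \<times> topspace Y"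
    using openin_subset[OF assms] by simp
  fix x y assume "(x, y) \<in> W"
  then obtain U V where "openin X U" "openin Y V" "x \<in> U" "y \<in> V" "U \<times> V \<subseteq> W"
    using assms unfolding openin_prod_topology_alt by meson
  then show "\<exists>U V. openin X U \<and> x \<in> U \<and> openin Y V \<and> y \<in> V \<and> {x} \<times> V \<union> U \<times> {y} \<subseteq> W"
    by (intro exI[of _ U] exI[of _ V]) auto
qed

lemma continuous_map_cross_prod:
  "continuous_map (cross_topology X Y) (prod_topology X Y) id"
  unfolding continuous_map_def
proof (intro conjI allI impI)
  show "id \<in> topspace (cross_topology X Y) \<rightarrow> topspace (prod_topology X Y)"
    by (simp add: topspace_cross_topology)
  fix W assume W: "openin (prod_topology X Y) W"
  then have "{p \<in> topspace (cross_topology X Y). id p \<in> W} = W"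
    using openin_subset by (fastforce simp: topspace_cross_topology)
  with W show "openin (cross_topology X Y) {p \<in> topspace (cross_topology X Y). id p \<in> W}"
    by (simp add: openin_cross_topology_if_openin_prod)
qed

lemma continuous_map_cross_fst: "continuous_map (cross_topology X Y) X fst"
  using continuous_map_compose[OF continuous_map_cross_prod continuous_map_fst] by simp

lemma continuous_map_cross_snd: "continuous_map (cross_topology X Y) Y snd"
  using continuous_map_compose[OF continuous_map_cross_prod continuous_map_snd] by simp

text \<open>A cross-neighborhood of a point is tested only on the two lines through that point. Each
  of these lines meets \<open>D\<close> in a finite set, which is closed by T1 and can be cut away.
  This makes scattered sets closed in the cross-topology, even ones that accumulate in the product
  topology; it drives both the compactness and the convergence result.\<close>

lemma closedin_cross_topology_finite_sections:
  assumes X: "t1_space X" and Y: "t1_space Y" and D: "D \<subseteq> topspace X \<times> topspace Y"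
    and rows: "\<And>x. x \<in> topspace X \<Longrightarrow> finite {y. (x, y) \<in> D}"
    and cols: "\<And>y. y \<in> topspace Y \<Longrightarrow> finite {x. (x, y) \<in> D}"
  shows "closedin (cross_topology X Y) D"
proof -
  have "openin (cross_topology X Y) (topspace X \<times> topspace Y - D)"
    unfolding cross_open_iff
  proof (intro conjI allI impI)
    fix x y assume xy: "(x, y) \<in> topspace X \<times> topspace Y - D"
    let ?U = "topspace X - {x. (x, y) \<in> D}" and ?V = "topspace Y - {y. (x, y) \<in> D}"
    have "closedin X {x. (x, y) \<in> D}"
      using X cols[of y] xy D unfolding t1_space_closedin_finite by blast
    moreover have "closedin Y {y. (x, y) \<in> D}"
      using Y rows[of x] xy D unfolding t1_space_closedin_finite by blast
    ultimately show "\<exists>U V. openin X U \<and> x \<in> U \<and> openin Y V \<and> y \<in> V \<and>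
        {x} \<times> V \<union> U \<times> {y} \<subseteq> topspace X \<times> topspace Y - D"
      using xy by (intro exI[of _ ?U] exI[of _ ?V]) auto
  qed auto
  then show ?thesis
    using D by (simp add: closedin_def topspace_cross_topology)
qed

lemma inj_on_Union_chain:
  assumes "subset.chain \<M> \<C>" and "\<And>D. D \<in> \<C> \<Longrightarrow> inj_on h D"
  shows "inj_on h (\<Union>\<C>)"
proof (rule inj_onI)
  fix p q assume "p \<in> \<Union>\<C>" "q \<in> \<Union>\<C>" and eq: "h p = h q"
  then obtain C D where "C \<in> \<C>" "D \<in> \<C>" "p \<in> C" "q \<in> D" by blast
  moreover from this have "C \<subseteq> D \<or> D \<subseteq> C"
    using assms(1) by (simp add: subset_chain_def)
  ultimately obtain D where "D \<in> \<C>" "p \<in> D" "q \<in> D" by blast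
  then show "p = q"
    using assms(2) eq by (metis inj_onD)
qed

text \<open>A maximal set of points of \<open>K\<close>, no two of which share a coordinate, is closed and discrete
  in the cross-topology, hence finite; by maximality the lines through its points cover \<open>K\<close>.\<close>

lemma compactin_cross_topology_subset_finite_lines:
  assumes X: "t1_space X" and Y: "t1_space Y" and K: "compactin (cross_topology X Y) K"
  obtains F G where "finite F" "finite G" "F \<subseteq> topspace X" "G \<subseteq> topspace Y"
    "\<And>p. p \<in> K \<Longrightarrow> fst p \<in> F \<or> snd p \<in> G"
proof -
  define \<M> where "\<M> = {D. D \<subseteq> K \<and> inj_on fst D \<and> inj_on snd D}"
  have KT: "K \<subseteq> topspace X \<times> topspace Y"
    using compactin_subset_topspace[OF K] by (simp add: topspace_cross_topology)
  have "\<exists>M\<in>\<M>. \<forall>D\<in>\<M>. M \<subseteq> D \<longrightarrow> D = M"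
  proof (rule subset_Zorn')
    fix \<C> assume \<C>: "subset.chain \<M> \<C>"
    have "inj_on fst (\<Union>\<C>)" "inj_on snd (\<Union>\<C>)"
      using \<C> by (auto intro!: inj_on_Union_chain[OF \<C>] simp: subset_chain_def \<M>_def)
    then show "\<Union>\<C> \<in> \<M>"
      using \<C> unfolding subset_chain_def \<M>_def by blast
  qed
  then obtain M where "M \<in> \<M>" and max: "\<And>D. D \<in> \<M> \<Longrightarrow> M \<subseteq> D \<Longrightarrow> D = M"
    by metis
  then have M: "M \<subseteq> K" "inj_on fst M" "inj_on snd M"
    by (auto simp: \<M>_def)
  \<comment> \<open>Every line meets \<open>M\<close> in at most one point, so not only
    \<open>M\<close> but each of its subsets is closed; hence \<open>M\<close> has no accumulation
    point.\<close>
  have closed: "closedin (cross_topology X Y) D" if "D \<subseteq> M" for D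
  proof (rule closedin_cross_topology_finite_sections[OF X Y])
    show "D \<subseteq> topspace X \<times> topspace Y"
      using that M(1) KT by blast
    have "{y. (x, y) \<in> D} \<subseteq> snd ` (fst -` {x} \<inter> M)" for x
      using that by force
    then show "finite {y. (x, y) \<in> D}" for x
      using finite_vimage_IntI[of "{x}" fst M] M(2) by (meson finite.intros finite_imageI finite_subset)
    have "{x. (x, y) \<in> D} \<subseteq> fst ` (snd -` {y} \<inter> M)" for y
      using that by force
    then show "finite {x. (x, y) \<in> D}" for y
      using finite_vimage_IntI[of "{y}" snd M] M(3) by (meson finite.intros finite_imageI finite_subset)
  qed
  have "finite M"
  proof (rule ccontr)
    assume "infinite M"
    then obtain z where z: "z \<in> cross_topology X Y derived_set_of M"
      using compactin_imp_Bolzano_Weierstrass[OF K] M(1) by blast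
    \<comment> \<open>Removing \<open>M - {z}\<close> leaves a neighborhood of \<open>z\<close> that
      contains no point of \<open>M\<close> other than possibly \<open>z\<close>, against the choice
      of \<open>z\<close>.\<close>
    have "openin (cross_topology X Y) (topspace (cross_topology X Y) - (M - {z}))"
      by (intro openin_diff openin_topspace closed) blast
    moreover have "z \<in> topspace (cross_topology X Y) - (M - {z})"
      using z by (simp add: in_derived_set_of)
    ultimately obtain y where "y \<noteq> z" "y \<in> M" "y \<in> topspace (cross_topology X Y) - (M - {z})"
      using z unfolding in_derived_set_of by metis
    then show False by blast
  qed
  show thesis
  proof
    show "finite (fst ` M)" "finite (snd ` M)"
      using \<open>finite M\<close> by auto
    show "fst ` M \<subseteq> topspace X" "snd ` M \<subseteq> topspace Y"
      using M(1) KT by auto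
    show "fst p \<in> fst ` M \<or> snd p \<in> snd ` M" if "p \<in> K" for p
    proof (rule ccontr)
      assume "\<not> (fst p \<in> fst ` M \<or> snd p \<in> snd ` M)"
      then have "insert p M \<in> \<M>" "p \<notin> M"
        using that M by (auto simp: \<M>_def)
      with max show False by blast
    qed
  qed
qed

lemma limitin_t1_finite_eq:
  assumes "t1_space X" and "limitin X z l sequentially" and "c \<in> topspace X" "c \<noteq> l"
  shows "finite {n. z n = c}"
proof -
  have "openin X (topspace X - {c})"
    using assms by (simp add: openin_diff t1_space_closedin_singleton)
  then have "\<forall>\<^sub>F n in sequentially. z n \<in> topspace X - {c}"
    using assms limitin_topspace[OF assms(2)] unfolding limitin_def by blast
  then have "\<forall>\<^sub>F n in sequentially. z n \<noteq> c"
    by (rule eventually_mono) auto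
  then show ?thesis
    by (simp add: eventually_cofinite flip: cofinite_eq_sequentially)
qed

text \<open>Let \<open>D\<close> be the set of terms off the cross through the limit. A line not
  through the limit carries only finitely many terms, because the coordinates converge in T1 spaces;
  a line through the limit carries no point of \<open>D\<close>. So \<open>D\<close> is closed, and
  its complement is a neighborhood of the limit that the sequence must eventually enter.\<close>

lemma limitin_cross_topology_eventually:
  assumes X: "t1_space X" and Y: "t1_space Y"
    and lim: "limitin (cross_topology X Y) z (x, y) sequentially"
  shows "\<forall>\<^sub>F n in sequentially. fst (z n) = x \<or> snd (z n) = y"
proof -
  define D where
    "D = {p \<in> range z. p \<in> topspace X \<times> topspace Y \<and> fst p \<noteq> x \<and> snd p \<noteq> y}"
  have limX: "limitin X (\<lambda>n. fst (z n)) x sequentially"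
    using continuous_map_limit[OF continuous_map_cross_fst lim] by (simp add: o_def)
  have limY: "limitin Y (\<lambda>n. snd (z n)) y sequentially"
    using continuous_map_limit[OF continuous_map_cross_snd lim] by (simp add: o_def)
  have "closedin (cross_topology X Y) D"
  proof (rule closedin_cross_topology_finite_sections[OF X Y])
    show "D \<subseteq> topspace X \<times> topspace Y"
      by (auto simp: D_def)
    show "finite {v. (u, v) \<in> D}" if u: "u \<in> topspace X" for u
    proof (cases "u = x")
      case False
      have "{v. (u, v) \<in> D} \<subseteq> (\<lambda>n. snd (z n)) ` {n. fst (z n) = u}"
        unfolding D_def by (auto simp: image_iff) (metis fst_conv snd_conv)
      with limitin_t1_finite_eq[OF X limX u False] show ?thesis
        by (metis finite_imageI finite_subset)
    qed (simp add: D_def)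
    show "finite {u. (u, v) \<in> D}" if v: "v \<in> topspace Y" for v
    proof (cases "v = y")
      case False
      have "{u. (u, v) \<in> D} \<subseteq> (\<lambda>n. fst (z n)) ` {n. snd (z n) = v}"
        unfolding D_def by (auto simp: image_iff) (metis fst_conv snd_conv)
      with limitin_t1_finite_eq[OF Y limY v False] show ?thesis
        by (metis finite_imageI finite_subset)
    qed (simp add: D_def)
  qed
  then have "openin (cross_topology X Y) (topspace (cross_topology X Y) - D)"
    by (rule openin_diff[OF openin_topspace])
  moreover have "(x, y) \<in> topspace (cross_topology X Y) - D"
    using limitin_topspace[OF lim] by (simp add: D_def)
  ultimately have "\<forall>\<^sub>F n in sequentially. z n \<in> topspace (cross_topology X Y) - D"
    using lim unfolding limitin_def by blast
  then show ?thesis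
    by (rule eventually_mono) (auto simp: D_def topspace_cross_topology)
qed

section \<open>Baire category inside a compact set\<close>

text \<open>Baire's theorem is applied to the subspace \<open>U\<close>, which is locally compact
  Hausdorff as an open subset of the compact Hausdorff subspace \<open>K\<close>. An interior taken
  relative to \<open>U\<close> is open in \<open>Z\<close>, since \<open>U\<close> is.\<close>

lemma compactin_Baire_open_subset:
  fixes C :: "nat \<Rightarrow> 'a set"
  assumes Z: "Hausdorff_space Z" and K: "compactin Z K" and U: "openin Z U" "U \<subseteq> K" "U \<noteq> {}"
    and C: "\<And>n. closedin Z (C n)" and cover: "U \<subseteq> (\<Union>n. C n)"
  obtains n W where "openin Z W" "W \<noteq> {}" "W \<subseteq> U" "W \<subseteq> C n"
proof -
  let ?K = "subtopology Z K" and ?U = "subtopology Z U"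
  have HK: "Hausdorff_space ?K" and HO: "Hausdorff_space ?U"
    using Z by (simp_all add: Hausdorff_space_subtopology)
  have "locally_compact_space ?K"
    using K by (intro compact_imp_locally_compact_space compact_space_subtopology)
  moreover have "openin ?K U"
    using U openin_subtopology_Int2[OF U(1), of K] by (simp add: inf_absorb2)
  ultimately have lc: "locally_compact_space ?U"
    using locally_compact_space_open_subset[of ?K U] HK U(2)
    by (simp add: subtopology_subtopology inf_absorb2)
  have "\<exists>n. ?U interior_of (U \<inter> C n) \<noteq> {}"
  proof (rule ccontr)
    assume contra: "\<nexists>n. ?U interior_of (U \<inter> C n) \<noteq> {}"
    have "?U interior_of \<Union>(range (\<lambda>n. U \<inter> C n)) = {}"
    proof (rule Baire_category_aux[OF lc])
      show "regular_space ?U"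
        using lc HO by (rule locally_compact_Hausdorff_imp_regular_space)
      show "closedin ?U T \<and> ?U interior_of T = {}" if "T \<in> range (\<lambda>n. U \<inter> C n)" for T
        using that contra C by (auto simp: closedin_subtopology_Int_closed)
    qed simp
    moreover have "topspace ?U = U"
      using openin_subset[OF U(1)] by auto
    moreover have "\<Union>(range (\<lambda>n. U \<inter> C n)) = U"
      using cover by auto
    ultimately show False
      using U(3) interior_of_topspace[of ?U] by simp
  qed
  then obtain n where n: "?U interior_of (U \<inter> C n) \<noteq> {}" by blast
  show thesis
  proof
    show "openin Z (?U interior_of (U \<inter> C n))"
      by (rule openin_trans_full[OF openin_interior_of U(1)])
    show "?U interior_of (U \<inter> C n) \<subseteq> U" "?U interior_of (U \<inter> C n) \<subseteq> C n"
      using interior_of_subset[of ?U "U \<inter> C n"] by auto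
  qed (rule n)
qed

section \<open>Connected boxes and maps that preserve one coordinate of each point\<close>

text \<open>A point outside \<open>F \<times> G\<close> lies on a full vertical line over some
  \<open>x \<notin> F\<close> or on a full horizontal line at some \<open>y \<notin> G\<close>. Such
  lines avoid \<open>F \<times> G\<close>, and all of them are tied together by one fixed cross
  through \<open>(a, b)\<close>.\<close>

lemma connectedin_Times_minus_finite_box:
  assumes A: "connectedin X A" and B: "connectedin Y B" and "A - F \<noteq> {}" "B - G \<noteq> {}"
  shows "connectedin (prod_topology X Y) (A \<times> B - F \<times> G)"
proof -
  obtain a b where a: "a \<in> A" "a \<notin> F" and b: "b \<in> B" "b \<notin> G"
    using assms by blast
  have vert: "connectedin (prod_topology X Y) ({x} \<times> B)" if "x \<in> A" for x
    using B that connectedin_subset_topspace[OF A] by (auto simp: connectedin_Times)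
  have horiz: "connectedin (prod_topology X Y) (A \<times> {y})" if "y \<in> B" for y
    using A that connectedin_subset_topspace[OF B] by (auto simp: connectedin_Times)
  \<comment> \<open>The first two lines meet in \<open>(a, y)\<close>, the last two in
    \<open>(x, b)\<close>, and both pairs contain \<open>(a, b)\<close>; the latter is common to all
    the sets \<open>T x y\<close>.\<close>
  define T where "T x y = ({a} \<times> B \<union> A \<times> {y}) \<union> (A \<times> {b} \<union> {x} \<times> B)" for x y
  have "connectedin (prod_topology X Y) (T x y)" if "x \<in> A" "y \<in> B" for x y
    unfolding T_def using that a b
    by (intro connectedin_Un vert horiz) auto
  then have "connectedin (prod_topology X Y) (\<Union>((\<lambda>(x, y). T x y) ` ((A - F) \<times> (B - G))))"
    using a b by (intro connectedin_Union) (auto simp: T_def)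
  moreover have "\<Union>((\<lambda>(x, y). T x y) ` ((A - F) \<times> (B - G))) = A \<times> B - F \<times> G"
    using a b by (fastforce simp: T_def)
  ultimately show ?thesis by simp
qed

lemma connectedin_t1_finite_imp_singleton:
  assumes "t1_space X" "connectedin X S" "finite S"
  shows "\<exists>c. S \<subseteq> {c}"
proof -
  have "topspace (subtopology X S) = S"
    using connectedin_subset_topspace[OF assms(2)] by auto
  then have "subtopology X S = discrete_topology S"
    using assms by (intro finite_t1_space_imp_discrete_topology) (auto simp: t1_space_subtopology)
  then show ?thesis
    using assms(2) by (simp add: connectedin_def connected_space_discrete_topology)
qed

lemma infinite_nonempty_open:
  assumes X: "t1_space X" and iso: "\<nexists>x. isolated_point_of X x" and U: "openin X U" "U \<noteq> {}"
  shows "infinite U"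
proof
  assume fin: "finite U"
  obtain x where x: "x \<in> U" using U by blast
  have "closedin X (U - {x})"
    using X fin openin_subset[OF U(1)] unfolding t1_space_closedin_finite by blast
  then have "openin X (U - (U - {x}))"
    using U by blast
  moreover have "U - (U - {x}) = {x}" using x by blast
  ultimately show False
    using iso openin_subset[OF U(1)] x unfolding isolated_point_of_def by auto
qed

text \<open>A finite open set would also be closed. This is meant for the subspaces on
  \<open>A\<close> and \<open>B\<close>: a relatively open subset need not be open in the ambient
  space, so the absence of isolated points there says nothing about it.\<close>

lemma connected_t1_infinite_open:
  assumes "t1_space X" "connected_space X" "infinite (topspace X)" "openin X U" "U \<noteq> {}"
  shows "infinite U"
proof
  assume "finite U"
  then have "closedin X U"
    using assms openin_subset[OF assms(4)] unfolding t1_space_closedin_finite by blast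
  then have "U = topspace X"
    using assms connected_space_clopen_in by blast
  with \<open>finite U\<close> assms show False by simp
qed

text \<open>The box with finite sets removed from both sides is dense: the sides of a nonempty open
  rectangle are infinite and so cannot be used up by \<open>F\<close> and \<open>G\<close>.\<close>

lemma closedin_prod_cofinite_box:
  assumes X: "t1_space X" "connected_space X" "infinite (topspace X)"
    and Y: "t1_space Y" "connected_space Y" "infinite (topspace Y)"
    and S: "closedin (prod_topology X Y) S" and F: "finite F" and G: "finite G"
    and sub: "(topspace X - F) \<times> (topspace Y - G) \<subseteq> S"
  shows "S = topspace X \<times> topspace Y"
proof (rule ccontr)
  assume "S \<noteq> topspace X \<times> topspace Y"
  then obtain x y where xy: "(x, y) \<in> topspace X \<times> topspace Y - S"
    using closedin_subset[OF S] by auto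
  moreover have "openin (prod_topology X Y) (topspace X \<times> topspace Y - S)"
    using S by (simp add: closedin_def)
  ultimately obtain U V where UV: "openin X U" "openin Y V" "x \<in> U" "y \<in> V"
    "U \<times> V \<subseteq> topspace X \<times> topspace Y - S"
    unfolding openin_prod_topology_alt by meson
  have "infinite U" "infinite V"
    using connected_t1_infinite_open[OF X UV(1)] connected_t1_infinite_open[OF Y UV(2)] UV by auto
  then obtain u v where "u \<in> U - F" "v \<in> V - G"
    using F G by (metis Diff_infinite_finite equals0I finite.emptyI)
  with UV sub show False by blast
qed

text \<open>The two kinds of points in the hypotheses \<open>cross\<close> and \<open>lines\<close> form closed sets that cover a
  dense subset, hence everything, and meet only in the finite set \<open>F \<times> G\<close>, whose complement is
  connected.\<close>

lemma coordinate_preserving_dichotomy: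
  assumes X: "Hausdorff_space X" and Y: "Hausdorff_space Y"
    and A: "connectedin X A" "infinite A" and B: "connectedin Y B" "infinite B"
    and f: "continuous_map (prod_topology X Y) (prod_topology X Y) f"
    and F: "finite F" "F \<subseteq> topspace X" and G: "finite G" "G \<subseteq> topspace Y"
    and lines: "\<And>p. p \<in> A \<times> B \<Longrightarrow> fst (f p) \<in> F \<or> snd (f p) \<in> G"
    and cross: "\<And>p. p \<in> A \<times> B \<Longrightarrow> fst (f p) = fst p \<or> snd (f p) = snd p"
  shows "(\<exists>c. \<forall>p\<in>A \<times> B. fst (f p) = c) \<or> (\<exists>d. \<forall>p\<in>A \<times> B. snd (f p) = d)"
proof -
  define P where "P = subtopology X A"
  define Q where "Q = subtopology Y B"
  have tP: "topspace P = A" and tQ: "topspace Q = B"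
    using connectedin_subset_topspace[OF A(1)] connectedin_subset_topspace[OF B(1)]
    by (auto simp: P_def Q_def)
  have P: "t1_space P" "connected_space P" "infinite (topspace P)"
    using X A tP by (auto simp: P_def t1_space_subtopology Hausdorff_imp_t1_space connectedin_def)
  have Q: "t1_space Q" "connected_space Q" "infinite (topspace Q)"
    using Y B tQ by (auto simp: Q_def t1_space_subtopology Hausdorff_imp_t1_space connectedin_def)
  let ?R = "prod_topology P Q"
  have R: "?R = subtopology (prod_topology X Y) (A \<times> B)"
    by (simp add: P_def Q_def subtopology_Times)
  have g: "continuous_map ?R X (\<lambda>p. fst (f p))" and h: "continuous_map ?R Y (\<lambda>p. snd (f p))"
    and pf: "continuous_map ?R X fst" and ps: "continuous_map ?R Y snd"
    using f unfolding R
    by (auto intro!: continuous_map_from_subtopology continuous_map_fst continuous_map_snd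
        simp: continuous_map_pairwise o_def)
  define S1 where "S1 = {p \<in> A \<times> B. fst (f p) \<in> F \<and> snd (f p) = snd p}"
  define S2 where "S2 = {p \<in> A \<times> B. fst (f p) = fst p \<and> snd (f p) \<in> G}"
  have clF: "closedin X F" and clG: "closedin Y G"
    using closedin_Hausdorff_finite X Y F G by blast+
  have "S1 = {p \<in> topspace ?R. fst (f p) \<in> F} \<inter> {p \<in> topspace ?R. snd (f p) = snd p}"
    by (auto simp: S1_def tP tQ)
  then have S1: "closedin ?R S1"
    using closedin_continuous_map_preimage[OF g clF] closedin_continuous_maps_eq[OF Y h ps]
    by (simp only: closedin_Int)
  have "S2 = {p \<in> topspace ?R. fst (f p) = fst p} \<inter> {p \<in> topspace ?R. snd (f p) \<in> G}"
    by (auto simp: S2_def tP tQ)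
  then have S2: "closedin ?R S2"
    using closedin_continuous_map_preimage[OF h clG] closedin_continuous_maps_eq[OF X g pf]
    by (simp only: closedin_Int)
  \<comment> \<open>A preserved first coordinate lies outside \<open>F\<close>, so
    \<open>lines\<close> puts the second one into \<open>G\<close>; symmetrically for a preserved
    second coordinate.\<close>
  have "(A - F) \<times> (B - G) \<subseteq> S1 \<union> S2"
    using lines cross unfolding S1_def S2_def by fastforce
  then have cover: "S1 \<union> S2 = A \<times> B"
    using closedin_prod_cofinite_box[OF P Q closedin_Un[OF S1 S2] F(1) G(1)] by (simp add: tP tQ)
  have "A - F \<noteq> {}" "B - G \<noteq> {}"
    using A B F G by (metis Diff_infinite_finite finite.emptyI)+
  then have con: "connectedin ?R (A \<times> B - F \<times> G)"
    using A(1) B(1) by (intro connectedin_Times_minus_finite_box) (auto simp: P_def Q_def connectedin_subtopology)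
  \<comment> \<open>On \<open>S1 \<inter> S2\<close> both coordinates are preserved, and they lie in
    \<open>F\<close> and \<open>G\<close>.\<close>
  have disj: "S1 \<inter> S2 \<inter> (A \<times> B - F \<times> G) = {}"
    by (auto simp: S1_def S2_def)
  have "S1 \<inter> (A \<times> B - F \<times> G) = {} \<or> S2 \<inter> (A \<times> B - F \<times> G) = {}"
    using con S1 S2 cover disj unfolding connectedin_closedin by blast
  then have "(A - F) \<times> (B - G) \<subseteq> S2 \<or> (A - F) \<times> (B - G) \<subseteq> S1"
    using cover by blast
  then have "S2 = A \<times> B \<or> S1 = A \<times> B"
    using closedin_prod_cofinite_box[OF P Q S1 F(1) G(1)]
      closedin_prod_cofinite_box[OF P Q S2 F(1) G(1)] by (auto simp: tP tQ)
  moreover have AB: "connectedin ?R (A \<times> B)"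
    using A(1) B(1) by (simp add: connectedin_Times P_def Q_def connectedin_subtopology)
  \<comment> \<open>A coordinate of \<open>f\<close> that takes finitely many values on the
    connected box is constant there.\<close>
  moreover have "\<exists>c. (\<lambda>p. fst (f p)) ` (A \<times> B) \<subseteq> {c}" if "S1 = A \<times> B"
  proof (rule connectedin_t1_finite_imp_singleton[OF Hausdorff_imp_t1_space[OF X]])
    show "finite ((\<lambda>p. fst (f p)) ` (A \<times> B))"
      unfolding that[symmetric] by (rule finite_subset[OF _ F(1)]) (auto simp: S1_def)
  qed (rule connectedin_continuous_map_image[OF g AB])
  moreover have "\<exists>d. (\<lambda>p. snd (f p)) ` (A \<times> B) \<subseteq> {d}" if "S2 = A \<times> B"
  proof (rule connectedin_t1_finite_imp_singleton[OF Hausdorff_imp_t1_space[OF Y]])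
    show "finite ((\<lambda>p. snd (f p)) ` (A \<times> B))"
      unfolding that[symmetric] by (rule finite_subset[OF _ G(1)]) (auto simp: S2_def)
  qed (rule connectedin_continuous_map_image[OF h AB])
  ultimately show ?thesis
    unfolding image_subset_iff singleton_iff by argo
qed

section \<open>Choice of the boxes and the final contradiction\<close>

lemma limitin_eventually_separated:
  assumes "Hausdorff_space X" "limitin X u x F" "limitin X v x' F" "x \<noteq> x'"
  shows "\<forall>\<^sub>F n in F. u n \<noteq> v n"
proof -
  obtain U V where "openin X U" "openin X V" "x \<in> U" "x' \<in> V" and UV: "disjnt U V"
    using assms unfolding Hausdorff_space_def by (metis limitin_topspace)
  then have "\<forall>\<^sub>F n in F. u n \<in> U" "\<forall>\<^sub>F n in F. v n \<in> V"
    using assms(2,3) unfolding limitin_def by blast+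
  then show ?thesis
    by eventually_elim (use UV in \<open>auto simp: disjnt_iff\<close>)
qed

text \<open>The chosen set is infinite because its nonempty interior is an open set in a space
  without isolated points.\<close>

lemma pi_pseudobase_infinite_connected_compact:
  assumes X: "t1_space X" and iso: "\<nexists>x. isolated_point_of X x" and U: "openin X U" "U \<noteq> {}"
    and base: "\<exists>\<A>. pi_pseudobase X \<A> \<and> (\<forall>A\<in>\<A>. connectedin X A \<and> compactin X A \<and> C1_set X A)"
  obtains A where "connectedin X A" "compactin X A" "A \<subseteq> U" "X interior_of A \<noteq> {}" "infinite A"
proof -
  obtain A where A: "connectedin X A" "compactin X A" "A \<subseteq> U" "X interior_of A \<noteq> {}"
    using base U unfolding pi_pseudobase_def by meson
  moreover have "infinite A"
    using infinite_nonempty_open[OF X iso openin_interior_of A(4)] interior_of_subset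
    by (metis finite_subset)
  ultimately show thesis by (rule that)
qed

lemma infinite_obtain_distinct:
  assumes "infinite A"
  obtains x x' where "x \<in> A" "x' \<in> A" "x \<noteq> x'"
proof -
  obtain x where "x \<in> A"
    using infinite_imp_nonempty[OF assms] by (auto simp: ex_in_conv[symmetric])
  moreover obtain x' where "x' \<in> A - {x}"
    using infinite_imp_nonempty[OF infinite_remove[OF assms]] by (auto simp: ex_in_conv[symmetric])
  ultimately show thesis
    using that[of x x'] by blast
qed

theorem theorem4p2:
  fixes X :: "'a topology" and Y :: "'b topology" and f :: "'a \<times> 'b \<Rightarrow> 'a \<times> 'b"
  assumes "topspace X \<noteq> {}" and "topspace Y \<noteq> {}"
    and "Hausdorff_space X" and "Hausdorff_space Y"
    and "\<nexists>x. isolated_point_of X x" and "\<nexists>y. isolated_point_of Y y"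
    and "\<exists>\<A>. pi_pseudobase X \<A> \<and>
              (\<forall>A\<in>\<A>. connectedin X A \<and> compactin X A \<and> C1_set X A)"
    and "\<exists>\<B>. pi_pseudobase Y \<B> \<and>
              (\<forall>B\<in>\<B>. connectedin Y B \<and> compactin Y B \<and> C1_set Y B)"
    and "\<And>x y. x \<in> topspace X \<Longrightarrow> y \<in> topspace Y \<Longrightarrow> f (x, y) = (x, y)"
  shows "f \<notin> baire_class_1 (prod_topology X Y) (cross_topology X Y)"
proof
  assume "f \<in> baire_class_1 (prod_topology X Y) (cross_topology X Y)"
  then obtain g where g: "\<And>n. continuous_map (prod_topology X Y) (cross_topology X Y) (g n)"
    and lim: "\<And>p. p \<in> topspace X \<times> topspace Y \<Longrightarrow>
      limitin (cross_topology X Y) (\<lambda>n. g n p) p sequentially"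
    using assms(9) by (force simp: baire_class_1_def)
  let ?Z = "prod_topology X Y"
  have t1: "t1_space X" "t1_space Y"
    using assms(3,4) by (simp_all add: Hausdorff_imp_t1_space)
  note piX = pi_pseudobase_infinite_connected_compact[OF t1(1) assms(5) _ _ assms(7)]
  note piY = pi_pseudobase_infinite_connected_compact[OF t1(2) assms(6) _ _ assms(8)]
  \<comment> \<open>Both sides now carry the product topology, where agreement of coordinates is a
    closed condition by the Hausdorff property.\<close>
  have gZ: "continuous_map ?Z ?Z (g n)" for n
    using continuous_map_compose[OF g continuous_map_cross_prod] by simp
  have g1: "continuous_map ?Z X (\<lambda>p. fst (g n p))" and g2: "continuous_map ?Z Y (\<lambda>p. snd (g n p))" for n
    using gZ[of n] by (simp_all add: continuous_map_pairwise o_def)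
  define E where "E n = {p \<in> topspace ?Z. fst (g n p) = fst p} \<union> {p \<in> topspace ?Z. snd (g n p) = snd p}" for n
  have "closedin ?Z (E n)" for n
    unfolding E_def by (intro closedin_Un closedin_continuous_maps_eq[OF assms(3) g1 continuous_map_fst]
        closedin_continuous_maps_eq[OF assms(4) g2 continuous_map_snd])
  then have closed: "closedin ?Z (\<Inter>n\<in>{m..}. E n)" for m
    by (intro closedin_INT) auto
  have cover: "topspace ?Z \<subseteq> (\<Union>m. \<Inter>n\<in>{m..}. E n)"
  proof
    fix p assume p: "p \<in> topspace ?Z"
    have "\<forall>\<^sub>F n in sequentially. fst (g n p) = fst p \<or> snd (g n p) = snd p"
      using limitin_cross_topology_eventually[OF t1, of "\<lambda>n. g n p" "fst p" "snd p"] lim p by auto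
    then show "p \<in> (\<Union>m. \<Inter>n\<in>{m..}. E n)"
      using p unfolding eventually_sequentially E_def by auto
  qed
  \<comment> \<open>\<open>A0\<close> and \<open>B0\<close> only supply a compact box with nonempty
    interior for Baire's theorem. The box used afterwards, \<open>A \<times> B\<close>, is chosen
    anew inside the open set \<open>W\<close>.\<close>
  obtain A0 where A0: "compactin X A0" "X interior_of A0 \<noteq> {}"
    by (rule piX[OF openin_topspace assms(1)])
  obtain B0 where B0: "compactin Y B0" "Y interior_of B0 \<noteq> {}"
    by (rule piY[OF openin_topspace assms(2)])
  obtain m W where W: "openin ?Z W" "W \<noteq> {}" "W \<subseteq> (\<Inter>n\<in>{m..}. E n)"
  proof (rule compactin_Baire_open_subset[of ?Z "A0 \<times> B0" "(X interior_of A0) \<times> (Y interior_of B0)"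
        "\<lambda>m. \<Inter>n\<in>{m..}. E n"])
    show "Hausdorff_space ?Z"
      using assms(3,4) by (simp add: Hausdorff_space_prod_topology)
    show "(X interior_of A0) \<times> (Y interior_of B0) \<subseteq> (\<Union>m. \<Inter>n\<in>{m..}. E n)"
      using cover interior_of_subset_topspace[of X A0] interior_of_subset_topspace[of Y B0]
      unfolding topspace_prod_topology by (elim order_trans[rotated]) (rule Sigma_mono)
    show "compactin ?Z (A0 \<times> B0)"
      using A0 B0 by (simp add: compactin_Times)
    show "(X interior_of A0) \<times> (Y interior_of B0) \<subseteq> A0 \<times> B0"
      by (intro Sigma_mono interior_of_subset)
  qed (use A0 B0 closed in \<open>auto simp: openin_prod_Times_iff\<close>)
  then obtain w where w: "w \<in> W" by blast
  obtain U V where UV: "openin X U" "openin Y V" "fst w \<in> U" "snd w \<in> V" "U \<times> V \<subseteq> W"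
    using W(1) w unfolding openin_prod_topology_alt by (metis prod.collapse)
  then have ne: "U \<noteq> {}" "V \<noteq> {}" by blast+
  obtain A where A: "connectedin X A" "compactin X A" "A \<subseteq> U" "infinite A"
    by (rule piX[OF UV(1) ne(1)])
  obtain B where B: "connectedin Y B" "compactin Y B" "B \<subseteq> V" "infinite B"
    by (rule piY[OF UV(2) ne(2)])
  have cpt: "compactin ?Z (A \<times> B)"
    using A B by (simp add: compactin_Times)
  then have AB: "A \<times> B \<subseteq> topspace ?Z"
    by (rule compactin_subset_topspace)
  have dich: "(\<exists>c. \<forall>p\<in>A \<times> B. fst (g n p) = c) \<or> (\<exists>d. \<forall>p\<in>A \<times> B. snd (g n p) = d)" if "m \<le> n" for n
  proof -
    \<comment> \<open>Here the continuity of \<open>g n\<close> into the cross-topology itself is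
      used: the image of the compact box is compact there.\<close>
    obtain F G where FG: "finite F" "finite G" "F \<subseteq> topspace X" "G \<subseteq> topspace Y"
      and lines: "\<And>q. q \<in> g n ` (A \<times> B) \<Longrightarrow> fst q \<in> F \<or> snd q \<in> G"
      using compactin_cross_topology_subset_finite_lines[OF t1 image_compactin[OF cpt g]] by metis
    have "A \<times> B \<subseteq> U \<times> V"
      using A(3) B(3) by (rule Sigma_mono)
    also have "\<dots> \<subseteq> W"
      by (rule UV(5))
    also have "\<dots> \<subseteq> E n"
      using W(3) that by blast
    finally have E: "A \<times> B \<subseteq> E n" .
    show ?thesis
    proof (rule coordinate_preserving_dichotomy[OF assms(3,4) A(1,4) B(1,4) gZ FG(1,3,2,4)])
      show "fst (g n p) \<in> F \<or> snd (g n p) \<in> G" if "p \<in> A \<times> B" for p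
        using that by (intro lines imageI)
      show "fst (g n p) = fst p \<or> snd (g n p) = snd p" if "p \<in> A \<times> B" for p
        using subsetD[OF E that] by (auto simp: E_def)
    qed
  qed
  obtain x x' where x: "x \<in> A" "x' \<in> A" "x \<noteq> x'"
    using A(4) by (rule infinite_obtain_distinct)
  obtain y y' where y: "y \<in> B" "y' \<in> B" "y \<noteq> y'"
    using B(4) by (rule infinite_obtain_distinct)
  have limX: "limitin X (\<lambda>n. fst (g n p)) (fst p) sequentially"
    and limY: "limitin Y (\<lambda>n. snd (g n p)) (snd p) sequentially" if "p \<in> A \<times> B" for p
  proof -
    have "p \<in> topspace X \<times> topspace Y"
      using that AB by auto
    from lim[OF this] show "limitin X (\<lambda>n. fst (g n p)) (fst p) sequentially"
      and "limitin Y (\<lambda>n. snd (g n p)) (snd p) sequentially"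
      using continuous_map_limit[OF continuous_map_cross_fst, of X Y "\<lambda>n. g n p" p]
        continuous_map_limit[OF continuous_map_cross_snd, of X Y "\<lambda>n. g n p" p]
      by (simp_all add: o_def)
  qed
  \<comment> \<open>Two points of the box with different first coordinates, and two with different
    second ones, are kept apart by \<open>g n\<close> for large \<open>n\<close>; so neither
    coordinate of \<open>g n\<close> can be constant on the box, against
    \<open>dich\<close>.\<close>
  have "\<forall>\<^sub>F n in sequentially. fst (g n (x, y)) \<noteq> fst (g n (x', y))"
    using limitin_eventually_separated[OF assms(3) limX limX, of "(x, y)" "(x', y)"] x y by simp
  moreover have "\<forall>\<^sub>F n in sequentially. snd (g n (x, y)) \<noteq> snd (g n (x, y'))"
    using limitin_eventually_separated[OF assms(4) limY limY, of "(x, y)" "(x, y')"] x y by simp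
  moreover have "\<forall>\<^sub>F n in sequentially. m \<le> n"
    by (rule eventually_ge_at_top)
  ultimately have "\<forall>\<^sub>F n in sequentially. False"
  proof eventually_elim
    case (elim n)
    with dich[of n] x y show False by (metis SigmaI)
  qed
  then show False by simp
qed

end
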